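(* Let $T$ be a denumerable set, $T'\subset T$ and $T''=T\setminus T'$. Let $\{g_t\}_{t\in T'}$ be a family of smooth functions on an open subset $W\subset\mathbb{R}^{T''}$ (i.e. $g_t\in\mathcal{F}(W)$), and let $V$ be the open set $W\times\mathbb{R}^{T'}$ in $\mathbb{R}^T$. Then the set $B=\{y_t+g_t\}_{t\in T'}\subset\mathcal{F}(V)$ is normalized and the set $$Z(B)=\{z\in V: f(z)=0 \text{ for all } f\in B\}$$ is a smooth manifold in $\mathbb{R}^T$.
   Context: $\mathbb{R}^T$ is the space of all maps $z:T\to\mathbb{R}$ with the product topology; $y_t(z)=z(t)$, $t\in T$, are the standard coordinate functions and $Y=\{y_t\}_{t\in T}$. For an open set $V\subset\mathbb{R}^T$, $\mathcal{F}(V)$ is the $\mathbb{R}$-algebra of real functions on $V$ that depend on finitely many coordinates and are smooth ($C^\infty$) as functions of a finite number of variables (similarly for $\mathbb{R}^{T''}$). Functions on $W$ are viewed as functions on $V=W\times\mathbb{R}^{T'}$ via the projection. A set $B\subset\mathcal{F}(V)$ is normalized if: (i) any $f\in B$ can be written $f=y_t+g$, where the coordinate functions $y_t$ so occurring form a set $\mathcal{L}$ and the functions $g$ do not depend on elements of $\mathcal{L}$; (ii) if $f_1=y_t+g_1$ and $f_2=y_t+g_2$ are in $B$, then $f_1=f_2$. A map $\phi:V\to\mathbb{R}^T$ is smooth if $y_t\circ\phi\in\mathcal{F}(V)$ for all $t\in T$. A diffeomorphism $V\to V'$ between open sets of $\mathbb{R}^T$ is a homeomorphism that is smooth together with its inverse.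 For $T^\star\subset T$ the coordinate subspace is $C_{T^\star}=\{z\in\mathbb{R}^T: z(t)=0\ \forall t\in T^\star\}$. A subset $M\subset\mathbb{R}^T$ is a smooth manifold if for any $a\in M$ there are a neighborhood $V\subset\mathbb{R}^T$ of $a$, an open subset $V'\subset\mathbb{R}^T$ and a diffeomorphism $\phi:V\to V'$ such that $\phi(V\cap M)=V'\cap C_{T^\star}$ for some coordinate subspace $C_{T^\star}$. *)

theory Defs
  imports "HOL-Analysis.Analysis"
begin

text \<open>
  Points of \<open>\<real>\<^sup>T\<close>, for an index set \<open>T :: 'a set\<close>, are the functions in
  \<open>topspace (powertop_real T) = (\<Pi>\<^sub>E t\<in>T. UNIV)\<close>, i.e. they are \<open>undefined\<close> outside \<open>T\<close>.
  For \<open>S \<subseteq> T\<close> the projection \<open>\<real>\<^sup>T \<rightarrow> \<real>\<^sup>S\<close> is \<open>\<lambda>z. restrict z S\<close>.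
\<close>

definition partial_deriv :: "'a \<Rightarrow> (('a \<Rightarrow> real) \<Rightarrow> real) \<Rightarrow> ('a \<Rightarrow> real) \<Rightarrow> real"
  where "partial_deriv s h z = deriv (\<lambda>x. h (z(s := x))) (z s)"

text \<open>
  \<open>C_k k S U h\<close>: for finite \<open>S\<close> and \<open>U\<close> open in \<open>\<real>\<^sup>S\<close>, the function \<open>h\<close> is of class \<open>C\<^sup>k\<close> on \<open>U\<close>,
  i.e. all its iterated partial derivatives of order at most \<open>k\<close> exist and are continuous on \<open>U\<close>.
\<close>

primrec C_k :: "nat \<Rightarrow> 'a set \<Rightarrow> ('a \<Rightarrow> real) set \<Rightarrow> (('a \<Rightarrow> real) \<Rightarrow> real) \<Rightarrow> bool" where
  "C_k 0 S U h \<longleftrightarrow> continuous_map (subtopology (powertop_real S) U) euclideanreal h"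
| "C_k (Suc k) S U h \<longleftrightarrow>
     continuous_map (subtopology (powertop_real S) U) euclideanreal h \<and>
     (\<forall>s\<in>S. (\<forall>z\<in>U. (\<lambda>x. h (z(s := x))) field_differentiable at (z s)) \<and>
             C_k k S U (partial_deriv s h))"

definition C_infinity :: "'a set \<Rightarrow> ('a \<Rightarrow> real) set \<Rightarrow> (('a \<Rightarrow> real) \<Rightarrow> real) \<Rightarrow> bool"
  where "C_infinity S U h \<longleftrightarrow> (\<forall>k. C_k k S U h)"

text \<open>
  The algebra \<open>\<F>(V)\<close> for \<open>V\<close> open in \<open>\<real>\<^sup>T\<close>. Its elements are taken to be \<open>undefined\<close>
  outside \<open>V\<close>, so that equality of elements is equality of functions on \<open>V\<close>. The image of \<open>V\<close>
  under the projection to \<open>\<real>\<^sup>S\<close> is again open.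
\<close>

definition smooth_functions ::
    "'a set \<Rightarrow> ('a \<Rightarrow> real) set \<Rightarrow> (('a \<Rightarrow> real) \<Rightarrow> real) set"
  where "smooth_functions T V =
    {f \<in> extensional V. \<exists>S h. finite S \<and> S \<subseteq> T \<and>
       C_infinity S ((\<lambda>z. restrict z S) ` V) h \<and> (\<forall>z\<in>V. f z = h (restrict z S))}"

definition independent_of ::
    "('a \<Rightarrow> real) set \<Rightarrow> 'a set \<Rightarrow> (('a \<Rightarrow> real) \<Rightarrow> real) \<Rightarrow> bool"
  where "independent_of V L g \<longleftrightarrow>
    (\<forall>z\<in>V. \<forall>w\<in>V. (\<forall>t. t \<notin> L \<longrightarrow> z t = w t) \<longrightarrow> g z = g w)"

text \<open>
  The decomposition \<open>f = y\<^sub>t + g\<close> of \<open>f \<in> B\<close> is given by \<open>t = \<tau> f\<close> and \<open>g = \<gamma> f\<close>; the set of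
  coordinate functions that occur is represented by its index set \<open>\<tau> ` B\<close>.
\<close>

definition normalized ::
    "'a set \<Rightarrow> ('a \<Rightarrow> real) set \<Rightarrow> (('a \<Rightarrow> real) \<Rightarrow> real) set \<Rightarrow> bool"
  where "normalized T V B \<longleftrightarrow> B \<subseteq> smooth_functions T V \<and>
    (\<exists>\<tau> \<gamma>.
       (\<forall>f\<in>B. \<tau> f \<in> T \<and> \<gamma> f \<in> smooth_functions T V \<and>
          f = (\<lambda>z\<in>V. z (\<tau> f) + \<gamma> f z) \<and> independent_of V (\<tau> ` B) (\<gamma> f)) \<and>
       (\<forall>f\<^sub>1\<in>B. \<forall>f\<^sub>2\<in>B. \<tau> f\<^sub>1 = \<tau> f\<^sub>2 \<longrightarrow> f\<^sub>1 = f\<^sub>2))"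

definition zero_set :: "('a \<Rightarrow> real) set \<Rightarrow> (('a \<Rightarrow> real) \<Rightarrow> real) set \<Rightarrow> ('a \<Rightarrow> real) set"
  where "zero_set V B = {z \<in> V. \<forall>f\<in>B. f z = 0}"

definition smooth_map ::
    "'a set \<Rightarrow> ('a \<Rightarrow> real) set \<Rightarrow> (('a \<Rightarrow> real) \<Rightarrow> ('a \<Rightarrow> real)) \<Rightarrow> bool"
  where "smooth_map T V \<phi> \<longleftrightarrow>
    \<phi> ` V \<subseteq> topspace (powertop_real T) \<and>
    (\<forall>t\<in>T. (\<lambda>z\<in>V. \<phi> z t) \<in> smooth_functions T V)"

definition diffeomorphism ::
    "'a set \<Rightarrow> ('a \<Rightarrow> real) set \<Rightarrow> ('a \<Rightarrow> real) set \<Rightarrow> (('a \<Rightarrow> real) \<Rightarrow> ('a \<Rightarrow> real)) \<Rightarrow> bool"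
  where "diffeomorphism T V V' \<phi> \<longleftrightarrow>
    openin (powertop_real T) V \<and> openin (powertop_real T) V' \<and>
    (\<exists>\<psi>. homeomorphic_maps (subtopology (powertop_real T) V) (subtopology (powertop_real T) V') \<phi> \<psi> \<and>
         smooth_map T V \<phi> \<and> smooth_map T V' \<psi>)"

definition coordinate_subspace :: "'a set \<Rightarrow> 'a set \<Rightarrow> ('a \<Rightarrow> real) set"
  where "coordinate_subspace T S = {z \<in> topspace (powertop_real T). \<forall>t\<in>S. z t = 0}"

definition smooth_manifold :: "'a set \<Rightarrow> ('a \<Rightarrow> real) set \<Rightarrow> bool"
  where "smooth_manifold T M \<longleftrightarrow>
    M \<subseteq> topspace (powertop_real T) \<and>
    (\<forall>a\<in>M. \<exists>V V' \<phi> S. a \<in> V \<and> S \<subseteq> T \<and> diffeomorphism T V V' \<phi> \<and>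
       \<phi> ` (V \<inter> M) = V' \<inter> coordinate_subspace T S)"

text \<open>
  The set \<open>W \<times> \<real>\<^bsup>T - T''\<^esup>\<close>, for \<open>W \<subseteq> \<real>\<^bsup>T''\<^esup>\<close>, as a subset of \<open>\<real>\<^sup>T\<close>.
\<close>

definition cylinder :: "'a set \<Rightarrow> 'a set \<Rightarrow> ('a \<Rightarrow> real) set \<Rightarrow> ('a \<Rightarrow> real) set"
  where "cylinder T T'' W = {z \<in> topspace (powertop_real T). restrict z T'' \<in> W}"

end

theory Submission
  imports Defs
begin

text \<open>
  The map \<open>\<phi>\<close> that adds \<open>g\<^sub>t\<close> to the coordinate \<open>y\<^sub>t\<close> for \<open>t \<in> T'\<close> and keeps the
  coordinates in \<open>T''\<close> is a diffeomorphism of \<open>V\<close> onto itself: its inverse subtracts \<open>g\<^sub>t\<close>,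
  since \<open>g\<^sub>t\<close> depends only on the coordinates that \<open>\<phi>\<close> keeps. It maps \<open>Z(B)\<close> onto
  \<open>V \<inter> C\<^bsub>T'\<^esub>\<close>, so this single chart works at every point of \<open>Z(B)\<close>.
\<close>

section \<open>Functions of class \<open>C\<^sup>k\<close>\<close>

lemma continuous_map_restrict_powertop_real:
  assumes "S \<subseteq> R"
  shows "continuous_map (powertop_real R) (powertop_real S) (\<lambda>z. restrict z S)"
  using assms by (auto simp: continuous_map_componentwise intro!: continuous_map_product_projection)

lemma restrict_fun_upd_in: "s \<in> S \<Longrightarrow> restrict (z(s := x)) S = (restrict z S)(s := x)"
  by (auto simp: fun_eq_iff)

lemma restrict_fun_upd_notin: "s \<notin> S \<Longrightarrow> restrict (z(s := x)) S = restrict z S"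
  by (auto simp: fun_eq_iff)

text \<open>A basic box around a point of \<open>V\<close> projects onto a box inside the image.
  This makes \<open>C_k_cong\<close> and \<open>C_k_add\<close> available on the sets that
  \<open>smooth_functions\<close> uses as domains.\<close>

lemma openin_restrict_image:
  assumes V: "openin (powertop_real T) V" and "S \<subseteq> T"
  shows "openin (powertop_real S) ((\<lambda>z. restrict z S) ` V)"
  unfolding openin_product_topology_alt
proof safe
  fix z assume "z \<in> V"
  then obtain U where U: "finite {i \<in> T. U i \<noteq> topspace euclideanreal}"
      "\<forall>i\<in>T. openin euclideanreal (U i)" "z \<in> Pi\<^sub>E T U" "Pi\<^sub>E T U \<subseteq> V"
    using V unfolding openin_product_topology_alt by blast
  have "w \<in> (\<lambda>z. restrict z S) ` V" if w: "w \<in> Pi\<^sub>E S U" for w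
  proof
    \<comment> \<open>A lift of \<open>w\<close>: the coordinates outside \<open>S\<close> are
      borrowed from the centre \<open>z\<close> of the box.\<close>
    let ?w = "\<lambda>i. if i \<in> S then w i else z i"
    have "?w \<in> Pi\<^sub>E T U"
      using w U(3) \<open>S \<subseteq> T\<close> by (auto simp: PiE_iff extensional_def)
    then show "?w \<in> V"
      using U(4) by blast
    show "w = restrict ?w S"
      using w by (auto simp: fun_eq_iff PiE_iff extensional_def)
  qed
  moreover have "finite {i \<in> S. U i \<noteq> topspace euclideanreal}"
    by (rule finite_subset[OF _ U(1)]) (use \<open>S \<subseteq> T\<close> in auto)
  moreover have "restrict z S \<in> Pi\<^sub>E S U"
    using U(3) \<open>S \<subseteq> T\<close> by auto
  ultimately show "\<exists>U. finite {i \<in> S. U i \<noteq> topspace euclideanreal} \<and>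
      (\<forall>i\<in>S. openin euclideanreal (U i)) \<and> restrict z S \<in> Pi\<^sub>E S U \<and>
      Pi\<^sub>E S U \<subseteq> (\<lambda>z. restrict z S) ` V"
    using U(2) \<open>S \<subseteq> T\<close> by (intro exI[of _ U]) auto
qed

text \<open>A coordinate line through \<open>z\<close> is a continuous curve, so it stays in the
  open set \<open>U\<close> for a while. Hence a partial derivative at \<open>z\<close> sees only
  values on \<open>U\<close>.\<close>

lemma eventually_fun_upd_mem:
  assumes U: "openin (powertop_real S) U" and "z \<in> U" "s \<in> S"
  shows "\<forall>\<^sub>F x in nhds (z s). z(s := x) \<in> U"
proof -
  have z: "z \<in> topspace (powertop_real S)"
    using openin_subset[OF U] \<open>z \<in> U\<close> by blast
  have "continuous_map euclideanreal (powertop_real S) (\<lambda>x. z(s := x))"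
    using z \<open>s \<in> S\<close> by (auto simp: continuous_map_componentwise PiE_iff extensional_def)
  then have "open {x. z(s := x) \<in> U}"
    using U by (force simp: continuous_map_def)
  then show ?thesis
    using \<open>z \<in> U\<close> by (auto simp: eventually_nhds intro!: exI[of _ "{x. z(s := x) \<in> U}"])
qed

section \<open>Closure properties of the class C^k\<close>

lemma continuous_map_subtopology_cong:
  assumes "\<And>z. z \<in> U \<Longrightarrow> f z = h z"
  shows "continuous_map (subtopology X U) Y f \<longleftrightarrow> continuous_map (subtopology X U) Y h"
  by (rule iffI; erule continuous_map_eq) (use assms in auto)

text \<open>Differentiability and derivatives depend only on germs along coordinate lines. The lemma
  is needed because \<open>partial_deriv\<close> is total, while rules such as the sum rule hold
  only at points of \<open>U\<close>.\<close>

lemma C_k_cong: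
  assumes "openin (powertop_real S) U" "\<And>z. z \<in> U \<Longrightarrow> f z = h z"
  shows "C_k k S U f \<longleftrightarrow> C_k k S U h"
  using assms(2)
proof (induction k arbitrary: f h)
  case 0
  then show ?case by (simp cong: continuous_map_subtopology_cong)
next
  case (Suc k)
  have ev: "\<forall>\<^sub>F x in nhds (z s). f (z(s := x)) = h (z(s := x))" if "z \<in> U" "s \<in> S" for z s
    using eventually_fun_upd_mem[OF assms(1) that] by eventually_elim (rule Suc.prems)
  have "(\<lambda>x. f (z(s := x))) field_differentiable at (z s) \<longleftrightarrow>
      (\<lambda>x. h (z(s := x))) field_differentiable at (z s)" if "z \<in> U" "s \<in> S" for z s
    unfolding field_differentiable_def using DERIV_cong_ev[OF refl ev[OF that] refl] by simp
  moreover have "C_k k S U (partial_deriv s f) \<longleftrightarrow> C_k k S U (partial_deriv s h)" if "s \<in> S" for s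
    by (rule Suc.IH) (auto simp: partial_deriv_def intro!: deriv_cong_ev ev that)
  moreover have "continuous_map (subtopology (powertop_real S) U) euclideanreal f \<longleftrightarrow>
      continuous_map (subtopology (powertop_real S) U) euclideanreal h"
    by (intro continuous_map_subtopology_cong Suc.prems)
  ultimately show ?case by auto
qed

lemma C_k_const: "C_k k S U (\<lambda>z. c)"
  by (induction k arbitrary: c) (auto simp: partial_deriv_def[abs_def])

lemma C_k_coordinate:
  assumes "t \<in> S"
  shows "C_k k S U (\<lambda>z. z t)"
proof -
  have "continuous_map (subtopology (powertop_real S) U) euclideanreal (\<lambda>z. z t)"
    using assms by (intro continuous_map_from_subtopology continuous_map_product_projection)
  \<comment> \<open>All first partial derivatives are constant, so a case split on \<open>k\<close>
    suffices, without induction.\<close>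
  moreover have "partial_deriv s (\<lambda>z. z t) = (\<lambda>z. if s = t then 1 else 0)" for s :: 'a
    by (auto simp: partial_deriv_def fun_eq_iff)
  moreover have "(\<lambda>x. (z(s := x)) t) field_differentiable at (z s)" for s and z :: "'a \<Rightarrow> real"
    by (cases "s = t") (auto simp: field_differentiable_ident)
  ultimately show ?thesis
    by (cases k) (simp_all add: C_k_const)
qed

lemma C_k_add:
  assumes "openin (powertop_real S) U" "C_k k S U f" "C_k k S U h"
  shows "C_k k S U (\<lambda>z. f z + h z)"
  using assms(2,3)
proof (induction k arbitrary: f h)
  case 0
  then show ?case by (auto intro: continuous_map_add)
next
  case (Suc k)
  have "C_k k S U (partial_deriv s (\<lambda>z. f z + h z))" if "s \<in> S" for s
  proof -
    \<comment> \<open>Differentiability of both summands is known on \<open>U\<close> only;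
      \<open>C_k_cong\<close> turns this pointwise identity into a statement about class
      C^k.\<close>
    have "partial_deriv s (\<lambda>z. f z + h z) z = partial_deriv s f z + partial_deriv s h z"
      if "z \<in> U" for z
      using Suc.prems \<open>s \<in> S\<close> that by (simp add: partial_deriv_def)
    moreover have "C_k k S U (\<lambda>z. partial_deriv s f z + partial_deriv s h z)"
      using Suc.prems \<open>s \<in> S\<close> by (intro Suc.IH) auto
    ultimately show ?thesis
      by (subst C_k_cong[OF assms(1)])
  qed
  then show ?case
    using Suc.prems by (auto intro!: continuous_map_add field_differentiable_add)
qed

lemma C_k_minus:
  assumes "openin (powertop_real S) U" "C_k k S U f"
  shows "C_k k S U (\<lambda>z. - f z)"
  using assms(2)
proof (induction k arbitrary: f)
  case 0
  then show ?case by (auto intro: continuous_map_minus)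
next
  case (Suc k)
  have "C_k k S U (partial_deriv s (\<lambda>z. - f z))" if "s \<in> S" for s
  proof -
    have "partial_deriv s (\<lambda>z. - f z) z = - partial_deriv s f z" if "z \<in> U" for z
      using Suc.prems \<open>s \<in> S\<close> that by (simp add: partial_deriv_def)
    moreover have "C_k k S U (\<lambda>z. - partial_deriv s f z)"
      using Suc.prems \<open>s \<in> S\<close> by (intro Suc.IH) auto
    ultimately show ?thesis
      by (subst C_k_cong[OF assms(1)])
  qed
  then show ?case
    using Suc.prems by (auto intro!: continuous_map_minus field_differentiable_minus)
qed

text \<open>Pullback along a projection: a derivative in a direction of \<open>S\<close> commutes
  with the projection, and one in any other direction is zero. With \<open>R = S\<close> the lemma
  merely shrinks the domain.\<close>

lemma C_k_restrict:
  assumes "S \<subseteq> R" "(\<lambda>z. restrict z S) ` U \<subseteq> U'" "C_k k S U' h"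
  shows "C_k k R U (\<lambda>z. h (restrict z S))"
  using assms(3)
proof (induction k arbitrary: h)
  \<comment> \<open>Established before the case distinction, since both the base case and the
    induction step compose with this projection.\<close>
  have cont: "continuous_map (subtopology (powertop_real R) U) (subtopology (powertop_real S) U')
      (\<lambda>z. restrict z S)"
    using continuous_map_restrict_powertop_real[OF assms(1)] assms(2)
    by (auto simp: continuous_map_in_subtopology continuous_map_from_subtopology)
  {
    case 0
    then show ?case
      using continuous_map_compose[OF cont] by (force simp only: C_k.simps comp_def)
  next
    case (Suc k)
    have "continuous_map (subtopology (powertop_real R) U) euclideanreal (\<lambda>z. h (restrict z S))"
      using Suc.prems continuous_map_compose[OF cont] by (force simp only: C_k.simps comp_def)
    moreover have "(\<lambda>x. h (restrict (z(s := x)) S)) field_differentiable at (z s)"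
      if "z \<in> U" for s z
    proof (cases "s \<in> S")
      case True
      have "(\<lambda>x. h ((restrict z S)(s := x))) field_differentiable at (restrict z S s)"
        using Suc.prems True assms(2) that by (simp only: C_k.simps image_subset_iff)
      then show ?thesis
        using True by (simp add: restrict_fun_upd_in)
    qed (simp add: restrict_fun_upd_notin)
    moreover have "C_k k R U (partial_deriv s (\<lambda>z. h (restrict z S)))" for s
    proof (cases "s \<in> S")
      case True
      then have "partial_deriv s (\<lambda>z. h (restrict z S)) = (\<lambda>z. partial_deriv s h (restrict z S))"
        by (simp add: partial_deriv_def fun_eq_iff restrict_fun_upd_in)
      moreover have "C_k k R U (\<lambda>z. partial_deriv s h (restrict z S))"
        by (rule Suc.IH) (use Suc.prems True in auto)
      ultimately show ?thesis
        by simp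
    next
      case False
      then have "partial_deriv s (\<lambda>z. h (restrict z S)) = (\<lambda>z. 0)"
        by (simp add: partial_deriv_def fun_eq_iff restrict_fun_upd_notin)
      then show ?thesis
        by (simp add: C_k_const)
    qed
    ultimately show ?case
      unfolding C_k.simps by blast
  }
qed

section \<open>The algebra of smooth functions\<close>

lemma smooth_functionsI:
  assumes "finite S" "S \<subseteq> T" "\<And>k. C_k k S ((\<lambda>z. restrict z S) ` V) h"
    "\<And>z. z \<in> V \<Longrightarrow> f z = h (restrict z S)"
  shows "(\<lambda>z\<in>V. f z) \<in> smooth_functions T V"
  using assms unfolding smooth_functions_def C_infinity_def by auto

lemma smooth_functionsE:
  assumes "f \<in> smooth_functions T V"
  obtains S h where "finite S" "S \<subseteq> T" "\<And>k. C_k k S ((\<lambda>z. restrict z S) ` V) h"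
    "\<And>z. z \<in> V \<Longrightarrow> f z = h (restrict z S)"
  using assms unfolding smooth_functions_def C_infinity_def by blast

lemma smooth_functions_coordinate:
  assumes "t \<in> T"
  shows "(\<lambda>z\<in>V. z t) \<in> smooth_functions T V"
  by (rule smooth_functionsI[of "{t}" _ _ "\<lambda>z. z t"]) (use assms in \<open>auto intro: C_k_coordinate\<close>)

text \<open>The summands may depend on different finite sets of coordinates, so both are pulled back
  to the union of these sets.\<close>

lemma smooth_functions_add:
  assumes V: "openin (powertop_real T) V"
    and f: "f \<in> smooth_functions T V" and g: "g \<in> smooth_functions T V"
  shows "(\<lambda>z\<in>V. f z + g z) \<in> smooth_functions T V"
proof -
  obtain S h where S: "finite S" "S \<subseteq> T" "\<And>k. C_k k S ((\<lambda>z. restrict z S) ` V) h"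
      "\<And>z. z \<in> V \<Longrightarrow> f z = h (restrict z S)"
    using smooth_functionsE[OF f] by metis
  obtain R j where R: "finite R" "R \<subseteq> T" "\<And>k. C_k k R ((\<lambda>z. restrict z R) ` V) j"
      "\<And>z. z \<in> V \<Longrightarrow> g z = j (restrict z R)"
    using smooth_functionsE[OF g] by metis
  show ?thesis
  proof (rule smooth_functionsI)
    show "finite (S \<union> R)" "S \<union> R \<subseteq> T"
      using S R by auto
    show "C_k k (S \<union> R) ((\<lambda>z. restrict z (S \<union> R)) ` V)
        (\<lambda>z. h (restrict z S) + j (restrict z R))" for k
      by (intro C_k_add openin_restrict_image[OF V] C_k_restrict[OF _ _ S(3)] C_k_restrict[OF _ _ R(3)])
        (use S R in \<open>auto simp: Int_absorb1\<close>)
    show "f z + g z = h (restrict (restrict z (S \<union> R)) S) + j (restrict (restrict z (S \<union> R)) R)"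
      if "z \<in> V" for z
      using S(4) R(4) that by (simp add: Int_absorb1)
  qed
qed

lemma smooth_functions_minus:
  assumes V: "openin (powertop_real T) V" and f: "f \<in> smooth_functions T V"
  shows "(\<lambda>z\<in>V. - f z) \<in> smooth_functions T V"
proof -
  obtain S h where S: "finite S" "S \<subseteq> T" "\<And>k. C_k k S ((\<lambda>z. restrict z S) ` V) h"
      "\<And>z. z \<in> V \<Longrightarrow> f z = h (restrict z S)"
    using smooth_functionsE[OF f] by metis
  show ?thesis
    by (rule smooth_functionsI[of S _ _ "\<lambda>z. - h z"])
      (use S in \<open>auto intro!: C_k_minus openin_restrict_image[OF V]\<close>)
qed

text \<open>This is the convention that functions on \<open>W\<close> count as functions on the
  cylinder over it. The finite set \<open>S\<close> of relevant coordinates stays the same.\<close>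

lemma smooth_functions_restrict:
  assumes "R \<subseteq> T" "(\<lambda>z. restrict z R) ` V \<subseteq> W" and g: "g \<in> smooth_functions R W"
  shows "(\<lambda>z\<in>V. g (restrict z R)) \<in> smooth_functions T V"
proof -
  obtain S h where S: "finite S" "S \<subseteq> R" "\<And>k. C_k k S ((\<lambda>z. restrict z S) ` W) h"
      "\<And>z. z \<in> W \<Longrightarrow> g z = h (restrict z S)"
    using smooth_functionsE[OF g] by metis
  have [simp]: "R \<inter> S = S"
    using S(2) by blast
  have "restrict z S \<in> (\<lambda>z. restrict z S) ` W" if "z \<in> V" for z
    using assms(2) that by (intro image_eqI[of _ _ "restrict z R"]) auto
  \<comment> \<open>The projection of \<open>V\<close> to the \<open>S\<close>-coordinates may be
    smaller than that of \<open>W\<close>. Here \<open>C_k_restrict\<close> goes from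
    \<open>S\<close> to \<open>S\<close>, whence the extra restriction in
    \<open>h (restrict z S)\<close>.\<close>
  then have "C_k k S ((\<lambda>z. restrict z S) ` V) (\<lambda>z. h (restrict z S))" for k
    by (intro C_k_restrict[OF _ _ S(3)]) auto
  moreover have "g (restrict z R) = h (restrict (restrict z S) S)" if "z \<in> V" for z
  proof -
    have "restrict z R \<in> W"
      using assms(2) that by blast
    then show ?thesis
      using S(4) by simp
  qed
  ultimately show ?thesis
    using S(1,2) \<open>R \<subseteq> T\<close> by (intro smooth_functionsI[of S _ _ "\<lambda>z. h (restrict z S)"]) auto
qed

section \<open>Smoothness implies continuity\<close>

lemma smooth_functions_imp_continuous_map:
  assumes f: "f \<in> smooth_functions T V"
  shows "continuous_map (subtopology (powertop_real T) V) euclideanreal f"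
proof -
  obtain S h where S: "S \<subseteq> T" "\<And>k. C_k k S ((\<lambda>z. restrict z S) ` V) h"
      "\<And>z. z \<in> V \<Longrightarrow> f z = h (restrict z S)"
    using smooth_functionsE[OF f] by metis
  have "C_k 0 T V (\<lambda>z. h (restrict z S))"
    by (rule C_k_restrict[OF S(1) _ S(2)]) simp
  then show ?thesis
    using S(3) by (auto elim!: continuous_map_eq)
qed

text \<open>In the product topology continuity may be checked coordinatewise. This supplies the
  continuity of a chart and of its inverse.\<close>

lemma smooth_map_imp_continuous_map:
  assumes "smooth_map T V \<phi>" "V \<subseteq> topspace (powertop_real T)"
  shows "continuous_map (subtopology (powertop_real T) V) (powertop_real T) \<phi>"
  unfolding continuous_map_componentwise
proof (intro conjI ballI)
  show "\<phi> ` topspace (subtopology (powertop_real T) V) \<subseteq> extensional T"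
    using assms by (auto simp: smooth_map_def PiE_iff)
  fix t assume "t \<in> T"
  then have "continuous_map (subtopology (powertop_real T) V) euclideanreal (\<lambda>z\<in>V. \<phi> z t)"
    using assms by (intro smooth_functions_imp_continuous_map) (auto simp: smooth_map_def)
  then show "continuous_map (subtopology (powertop_real T) V) euclideanreal (\<lambda>z. \<phi> z t)"
    by (rule continuous_map_eq) auto
qed

section \<open>Shears over a cylinder\<close>

lemma openin_cylinder:
  assumes "openin (powertop_real R) W" "R \<subseteq> T"
  shows "openin (powertop_real T) (cylinder T R W)"
  using continuous_map_restrict_powertop_real[OF assms(2)] assms(1)
  unfolding cylinder_def continuous_map_def by blast

text \<open>In the application \<open>R\<close> is \<open>T''\<close>. Each remaining coordinate is
  translated by an amount depending only on the fixed coordinates, as in a linear shear. The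
  restriction to \<open>T\<close> keeps values \<open>undefined\<close> outside
  \<open>T\<close>.\<close>

definition shear ::
    "'a set \<Rightarrow> 'a set \<Rightarrow> ('a \<Rightarrow> ('a \<Rightarrow> real) \<Rightarrow> real) \<Rightarrow> ('a \<Rightarrow> real) \<Rightarrow> ('a \<Rightarrow> real)"
  where "shear T R g z = (\<lambda>t\<in>T. if t \<in> R then z t else z t + g t (restrict z R))"

lemma restrict_shear: "R \<subseteq> T \<Longrightarrow> restrict (shear T R g z) R = restrict z R"
  by (auto simp: shear_def fun_eq_iff)

lemma shear_in_cylinder: "R \<subseteq> T \<Longrightarrow> z \<in> cylinder T R W \<Longrightarrow> shear T R g z \<in> cylinder T R W"
  by (auto simp: cylinder_def restrict_shear) (auto simp: shear_def)

text \<open>The first shear keeps the \<open>R\<close>-coordinates, so the second one evaluates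
  \<open>h\<close> at the same base point and cancels \<open>g\<close>. The symmetric sign condition
  serves both orders of composition.\<close>

lemma shear_minus_shear:
  assumes "R \<subseteq> T" "z \<in> cylinder T R W" "\<And>t. h t (restrict z R) = - g t (restrict z R)"
  shows "shear T R h (shear T R g z) = z"
proof
  fix t
  have "shear T R h (shear T R g z) t =
      (\<lambda>t\<in>T. if t \<in> R then shear T R g z t else shear T R g z t + h t (restrict z R)) t"
    using restrict_shear[OF assms(1)] by (simp add: shear_def[of T R h])
  also have "\<dots> = z t"
    using assms by (auto simp: shear_def cylinder_def PiE_iff extensional_def)
  finally show "shear T R h (shear T R g z) t = z t" .
qed

text \<open>The hypothesis speaks of \<open>g t\<close> cut off outside \<open>W\<close>, so that it
  also covers the inverse shear, where a negated function need not be \<open>undefined\<close>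
  there.\<close>

lemma smooth_map_shear:
  assumes W: "openin (powertop_real R) W" and "R \<subseteq> T"
    and g: "\<And>t. t \<in> T - R \<Longrightarrow> (\<lambda>z\<in>W. g t z) \<in> smooth_functions R W"
  shows "smooth_map T (cylinder T R W) (shear T R g)"
  unfolding smooth_map_def
proof (intro conjI ballI)
  let ?V = "cylinder T R W"
  have V: "openin (powertop_real T) ?V" and proj: "(\<lambda>z. restrict z R) ` ?V \<subseteq> W"
    using openin_cylinder[OF W \<open>R \<subseteq> T\<close>] by (auto simp: cylinder_def)
  show "shear T R g ` ?V \<subseteq> topspace (powertop_real T)"
    by (auto simp: shear_def)
  fix t assume t: "t \<in> T"
  show "(\<lambda>z\<in>?V. shear T R g z t) \<in> smooth_functions T ?V"
  proof (cases "t \<in> R")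
    case True
    then show ?thesis
      using t smooth_functions_coordinate[of t T ?V] by (simp add: shear_def)
  next
    case False
    then have gt: "(\<lambda>z\<in>W. g t z) \<in> smooth_functions R W"
      using t g by blast
    \<comment> \<open>The nested restrictions are the form that the closure lemmas produce; on
      \<open>?V\<close> they collapse because \<open>?V\<close> projects into
      \<open>W\<close>.\<close>
    have "(\<lambda>z\<in>?V. (\<lambda>z\<in>?V. z t) z + (\<lambda>z\<in>?V. (\<lambda>z\<in>W. g t z) (restrict z R)) z)
        \<in> smooth_functions T ?V"
      by (intro smooth_functions_add V smooth_functions_coordinate t
          smooth_functions_restrict[OF \<open>R \<subseteq> T\<close> proj gt])
    also have "(\<lambda>z\<in>?V. (\<lambda>z\<in>?V. z t) z + (\<lambda>z\<in>?V. (\<lambda>z\<in>W. g t z) (restrict z R)) z)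
        = (\<lambda>z\<in>?V. shear T R g z t)"
      using t False proj by (auto simp: shear_def fun_eq_iff restrict_def)
    finally show ?thesis .
  qed
qed

lemma diffeomorphism_shear:
  assumes W: "openin (powertop_real R) W" and R: "R \<subseteq> T"
    and g: "\<And>t. t \<in> T - R \<Longrightarrow> g t \<in> smooth_functions R W"
  shows "diffeomorphism T (cylinder T R W) (cylinder T R W) (shear T R g)"
proof -
  let ?V = "cylinder T R W" and ?h = "\<lambda>t z. - g t z"
  have V: "openin (powertop_real T) ?V"
    by (rule openin_cylinder[OF W R])
  have g': "(\<lambda>z\<in>W. g t z) \<in> smooth_functions R W" if "t \<in> T - R" for t
    using g[OF that] by (simp add: smooth_functions_def extensional_restrict)
  have smooth: "smooth_map T ?V (shear T R g)" "smooth_map T ?V (shear T R ?h)"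
    using g g' by (auto intro!: smooth_map_shear smooth_functions_minus W R)
  have "homeomorphic_maps (subtopology (powertop_real T) ?V) (subtopology (powertop_real T) ?V)
      (shear T R g) (shear T R ?h)"
    unfolding homeomorphic_maps_def continuous_map_in_subtopology
    using smooth[THEN smooth_map_imp_continuous_map[OF _ openin_subset[OF V]]]
    by (auto simp: shear_in_cylinder[OF R] intro!: shear_minus_shear[OF R])
  then show ?thesis
    using V smooth unfolding diffeomorphism_def by blast
qed

text \<open>The left side of the equation with index \<open>t\<close> is exactly the new coordinate
  \<open>t\<close> of the sheared point, so the equations turn into vanishing coordinates.\<close>

lemma shear_image_zero_set:
  assumes R: "R \<subseteq> T" and V: "V = cylinder T R W"
    and Z: "Z = {z \<in> V. \<forall>t\<in>T - R. z t + g t (restrict z R) = 0}"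
  shows "shear T R g ` Z = V \<inter> coordinate_subspace T (T - R)"
proof (intro equalityI subsetI)
  fix w assume "w \<in> shear T R g ` Z"
  then obtain z where z: "z \<in> V" "\<forall>t\<in>T - R. z t + g t (restrict z R) = 0" "w = shear T R g z"
    using Z by auto
  have "w \<in> V"
    using z V by (simp add: shear_in_cylinder[OF R])
  moreover have "\<forall>t\<in>T - R. w t = 0"
    using z by (simp add: shear_def)
  ultimately show "w \<in> V \<inter> coordinate_subspace T (T - R)"
    using V by (auto simp: coordinate_subspace_def cylinder_def)
next
  fix w assume w: "w \<in> V \<inter> coordinate_subspace T (T - R)"
  \<comment> \<open>The inverse shear solves the equations: as \<open>w t = 0\<close> off
    \<open>R\<close>, it sets coordinate \<open>t\<close> to \<open>- g t\<close> at the base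
    point.\<close>
  let ?z = "shear T R (\<lambda>t z. - g t z) w"
  have "?z \<in> V"
    using w V by (simp add: shear_in_cylinder[OF R])
  moreover have "?z t + g t (restrict ?z R) = 0" if "t \<in> T - R" for t
    unfolding restrict_shear[OF R] using that w by (simp add: shear_def coordinate_subspace_def)
  moreover have "shear T R g ?z = w"
    using w V by (intro shear_minus_shear[OF R]) auto
  ultimately show "w \<in> shear T R g ` Z"
    using Z by (intro image_eqI[of _ _ ?z]) auto
qed

section \<open>Normalized sets\<close>

text \<open>The leading indices all lie in \<open>T - R\<close>, whereas the remainders see only
  coordinates in \<open>R\<close>; this disjointness gives the required independence.\<close>

lemma normalized_graph_equations:
  assumes V: "openin (powertop_real T) V" and R: "R \<subseteq> T" and proj: "(\<lambda>z. restrict z R) ` V \<subseteq> W"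
    and g: "\<And>t. t \<in> T - R \<Longrightarrow> g t \<in> smooth_functions R W"
    and B: "B = (\<lambda>t. \<lambda>z\<in>V. z t + g t (restrict z R)) ` (T - R)"
  shows "normalized T V B"
proof -
  have smooth_g: "(\<lambda>z\<in>V. g t (restrict z R)) \<in> smooth_functions T V" if "t \<in> T - R" for t
    by (rule smooth_functions_restrict[OF R proj g[OF that]])
  have "(\<lambda>z\<in>V. z t + g t (restrict z R)) \<in> smooth_functions T V" if t: "t \<in> T - R" for t
  proof -
    have "(\<lambda>z\<in>V. z t) \<in> smooth_functions T V"
      using t by (intro smooth_functions_coordinate) auto
    from smooth_functions_add[OF V this smooth_g[OF t]] show ?thesis
      by (simp cong: restrict_cong)
  qed
  then have B_smooth: "B \<subseteq> smooth_functions T V"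
    using B by blast
  define F where "F t = (\<lambda>z\<in>V. z t + g t (restrict z R))" for t
  \<comment> \<open>A choice of index for each equation. If \<open>V\<close> is empty, all
    \<open>F t\<close> coincide, so \<open>F\<close> need not be injective;
    \<open>F (\<tau> f) = f\<close> is all that the uniqueness condition requires.\<close>
  define \<tau> where "\<tau> = inv_into (T - R) F"
  have B_eq: "B = F ` (T - R)"
    unfolding B F_def ..
  have \<tau>: "\<tau> f \<in> T - R" "F (\<tau> f) = f" if "f \<in> B" for f
    using that unfolding \<tau>_def B_eq by (rule inv_into_into, rule f_inv_into_f)
  let ?\<gamma> = "\<lambda>f. \<lambda>z\<in>V. g (\<tau> f) (restrict z R)"
  have indep: "independent_of V (\<tau> ` B) (?\<gamma> f)" for f
    unfolding independent_of_def
  proof (intro ballI impI)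
    fix z w assume "z \<in> V" "w \<in> V" and agree: "\<forall>t. t \<notin> \<tau> ` B \<longrightarrow> z t = w t"
    have "restrict z R = restrict w R"
    proof (rule restrict_ext)
      fix t assume "t \<in> R"
      then have "t \<notin> \<tau> ` B"
        using \<tau>(1) by blast
      then show "z t = w t"
        using agree by blast
    qed
    then show "?\<gamma> f z = ?\<gamma> f w"
      using \<open>z \<in> V\<close> \<open>w \<in> V\<close> by simp
  qed
  have decomp: "f = (\<lambda>z\<in>V. z (\<tau> f) + ?\<gamma> f z)" if "f \<in> B" for f
  proof -
    have "f = F (\<tau> f)"
      using \<tau>(2)[OF that] by (rule sym)
    also have "\<dots> = (\<lambda>z\<in>V. z (\<tau> f) + ?\<gamma> f z)"
      by (simp add: F_def cong: restrict_cong)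
    finally show ?thesis .
  qed
  have inj: "f\<^sub>1 = f\<^sub>2" if "f\<^sub>1 \<in> B" "f\<^sub>2 \<in> B" "\<tau> f\<^sub>1 = \<tau> f\<^sub>2" for f\<^sub>1 f\<^sub>2
    using \<tau>(2)[OF that(1)] \<tau>(2)[OF that(2)] that(3) by metis
  show ?thesis
    unfolding normalized_def
  proof (intro conjI exI[of _ \<tau>] exI[of _ ?\<gamma>] ballI impI)
    fix f assume "f \<in> B"
    then show "\<tau> f \<in> T" "?\<gamma> f \<in> smooth_functions T V"
      using \<tau>(1) smooth_g by blast+
    show "f = (\<lambda>z\<in>V. z (\<tau> f) + ?\<gamma> f z)"
      by (rule decomp) fact
    show "independent_of V (\<tau> ` B) (?\<gamma> f)"
      by (rule indep)
  next
    fix f\<^sub>1 f\<^sub>2 assume "f\<^sub>1 \<in> B" "f\<^sub>2 \<in> B" "\<tau> f\<^sub>1 = \<tau> f\<^sub>2"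
    then show "f\<^sub>1 = f\<^sub>2"
      by (rule inj)
  qed (rule B_smooth)
qed

theorem proposition2p7:
  fixes T T' T'' :: "'a set"
    and W V :: "('a \<Rightarrow> real) set"
    and g :: "'a \<Rightarrow> ('a \<Rightarrow> real) \<Rightarrow> real"
    and B :: "(('a \<Rightarrow> real) \<Rightarrow> real) set"
  assumes "countable T"
    and "T' \<subseteq> T"
    and "T'' = T - T'"
    and "openin (powertop_real T'') W"
    and "\<And>t. t \<in> T' \<Longrightarrow> g t \<in> smooth_functions T'' W"
    and "V = cylinder T T'' W"
    and "B = (\<lambda>t. \<lambda>z\<in>V. z t + g t (restrict z T'')) ` T'"
  shows "openin (powertop_real T) V \<and> normalized T V B \<and> smooth_manifold T (zero_set V B)"
proof -
  have T'': "T'' \<subseteq> T" and T': "T' = T - T''"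
    using assms(2,3) by auto
  have g: "g t \<in> smooth_functions T'' W" if "t \<in> T - T''" for t
    using that T' assms(5) by blast
  have V: "openin (powertop_real T) V"
    using openin_cylinder[OF assms(4) T''] assms(6) by simp
  moreover have "(\<lambda>z. restrict z T'') ` V \<subseteq> W"
    using assms(6) by (auto simp: cylinder_def)
  then have "normalized T V B"
    by (rule normalized_graph_equations[OF V T'' _ g]) (use assms(7) T' in simp_all)
  moreover have "smooth_manifold T (zero_set V B)"
    unfolding smooth_manifold_def
  proof (intro conjI ballI)
    show "zero_set V B \<subseteq> topspace (powertop_real T)"
      using openin_subset[OF V] by (auto simp: zero_set_def)
    fix a assume "a \<in> zero_set V B"
    then have "a \<in> V"
      by (simp add: zero_set_def)
    moreover have "diffeomorphism T V V (shear T T'' g)"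
      using diffeomorphism_shear[OF assms(4) T'' g] assms(6) by simp
    \<comment> \<open>Passes from equations indexed by the functions in \<open>B\<close> to
      equations indexed by \<open>t\<close>, the form used by
      \<open>shear_image_zero_set\<close>.\<close>
    moreover have "V \<inter> zero_set V B = {z \<in> V. \<forall>t\<in>T - T''. z t + g t (restrict z T'') = 0}"
      using assms(7) T' by (auto simp: zero_set_def)
    then have "shear T T'' g ` (V \<inter> zero_set V B) = V \<inter> coordinate_subspace T T'"
      using shear_image_zero_set[OF T'' assms(6)] T' by simp
    ultimately show "\<exists>V\<^sub>1 V' \<phi> S. a \<in> V\<^sub>1 \<and> S \<subseteq> T \<and> diffeomorphism T V\<^sub>1 V' \<phi> \<and>
        \<phi> ` (V\<^sub>1 \<inter> zero_set V B) = V' \<inter> coordinate_subspace T S"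
      using assms(2) by blast
  qed
  ultimately show ?thesis by blast
qed

end
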